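(* Let $K$ and $L$ be regular languages over a common finite non-empty alphabet $\Sigma$ with $\kappa(K)=m$ and $\kappa(L)=n$. Then the state complexity $\kappa(K \sqcup\!\sqcup L)$ of the shuffle of $K$ and $L$ is at most $$f(m,n)=2^{mn-1} + 2^{(m-1)(n-1)}(2^{m-1}-1)(2^{n-1}-1).$$
   Context: The state complexity $\kappa(L)$ of a regular language $L$ over $\Sigma$ is the number of states of the minimal complete deterministic finite automaton over $\Sigma$ recognizing $L$. The shuffle of words $u,v\in\Sigma^*$ is $u \sqcup\!\sqcup v=\{u_1v_1\cdots u_kv_k \mid u=u_1\cdots u_k,\ v=v_1\cdots v_k,\ u_1,\ldots,u_k,v_1,\ldots,v_k\in\Sigma^*\}$, and the shuffle of languages $K,L\subseteq\Sigma^*$ is $K \sqcup\!\sqcup L=\bigcup_{u\in K,\,v\in L} u \sqcup\!\sqcup v$. *)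

theory Defs
  imports Main
begin

record ('s, 'a) dfa =
  states :: "'s set"
  initial :: 's
  final :: "'s set"
  step :: "'s \<Rightarrow> 'a \<Rightarrow> 's"

text \<open>Completeness of the automaton: \<open>step\<close> is a total function that maps
  \<open>states \<times> \<Sigma>\<close> into \<open>states\<close>; its values elsewhere are irrelevant.\<close>

definition complete_dfa :: "'a set \<Rightarrow> ('s, 'a) dfa \<Rightarrow> bool" where
  "complete_dfa \<Sigma> M \<longleftrightarrow>
     finite (states M) \<and> initial M \<in> states M \<and> final M \<subseteq> states M \<and>
     (\<forall>q\<in>states M. \<forall>a\<in>\<Sigma>. step M q a \<in> states M)"

definition dfa_lang :: "'a set \<Rightarrow> ('s, 'a) dfa \<Rightarrow> 'a list set" where
  "dfa_lang \<Sigma> M = {w \<in> lists \<Sigma>. foldl (step M) (initial M) w \<in> final M}"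

text \<open>Natural numbers suffice as states, because state sets are finite; see
  \<open>complete_dfa_nat_states\<close> below.\<close>

definition regular_lang :: "'a set \<Rightarrow> 'a list set \<Rightarrow> bool" where
  "regular_lang \<Sigma> L \<longleftrightarrow>
     (\<exists>M :: (nat, 'a) dfa. complete_dfa \<Sigma> M \<and> dfa_lang \<Sigma> M = L)"

text \<open>Only meaningful for regular languages: otherwise \<open>LEAST\<close> is unspecified.\<close>

definition state_complexity :: "'a set \<Rightarrow> 'a list set \<Rightarrow> nat" where
  "state_complexity \<Sigma> L =
     (LEAST k. \<exists>M :: (nat, 'a) dfa. complete_dfa \<Sigma> M \<and> dfa_lang \<Sigma> M = L \<and> card (states M) = k)"

definition shuffle_lang :: "'a list set \<Rightarrow> 'a list set \<Rightarrow> 'a list set" where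
  "shuffle_lang K L = (\<Union>u\<in>K. \<Union>v\<in>L. shuffles u v)"

lemma complete_dfa_nat_states:
  fixes M :: "('s, 'a) dfa"
  assumes M: "complete_dfa \<Sigma> M"
  shows "\<exists>N :: (nat, 'a) dfa. complete_dfa \<Sigma> N \<and> dfa_lang \<Sigma> N = dfa_lang \<Sigma> M \<and>
           card (states N) = card (states M)"
proof -
  have fin: "finite (states M)" and ini: "initial M \<in> states M" and fn: "final M \<subseteq> states M"
    and tr: "\<And>q a. q \<in> states M \<Longrightarrow> a \<in> \<Sigma> \<Longrightarrow> step M q a \<in> states M"
    using M by (auto simp: complete_dfa_def)
  obtain h :: "'s \<Rightarrow> nat" where inj: "inj_on h (states M)"
    using finite_imp_inj_to_nat_seg[OF fin] by auto
  define g where "g = inv_into (states M) h"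
  have g: "g (h q) = q" if "q \<in> states M" for q
    using inj that by (simp add: g_def)
  define N :: "(nat, 'a) dfa" where
    "N = \<lparr>states = h ` states M, initial = h (initial M), final = h ` final M,
          step = (\<lambda>p a. h (step M (g p) a))\<rparr>"
  have "complete_dfa \<Sigma> N"
    using fin ini fn tr g by (auto simp: complete_dfa_def N_def)
  moreover have run: "foldl (step N) (h q) w = h (foldl (step M) q w) \<and> foldl (step M) q w \<in> states M"
    if "q \<in> states M" "w \<in> lists \<Sigma>" for q w
    using that
  proof (induction w arbitrary: q)
    case (Cons a w)
    then show ?case using tr[of q a] g[of q] by (simp add: N_def)
  qed simp
  have "dfa_lang \<Sigma> N = dfa_lang \<Sigma> M"
  proof -
    have "h x \<in> h ` final M \<longleftrightarrow> x \<in> final M" if "x \<in> states M" for x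
      using inj_on_image_mem_iff[OF inj that fn] .
    moreover have "initial N = h (initial M)" "final N = h ` final M"
      by (simp_all add: N_def)
    ultimately show ?thesis
      unfolding dfa_lang_def using run[OF ini] by (intro Collect_cong conj_cong refl) metis
  qed
  moreover have "card (states N) = card (states M)"
    using card_image[OF inj] by (simp add: N_def)
  ultimately show ?thesis by blast
qed

lemma shuffles_append:
  "w \<in> shuffles u v \<Longrightarrow> x @ y @ w \<in> shuffles (x @ u) (y @ v)"
proof (induction x)
  case Nil
  then show ?case
    by (induction y) (auto intro: Cons_in_shuffles_rightI)
next
  case (Cons a x)
  then show ?case by (auto intro: Cons_in_shuffles_leftI)
qed

text \<open>The library's \<open>shuffles\<close> is the set of all \<open>u\<^sub>1 v\<^sub>1 \<dots> u\<^sub>k v\<^sub>k\<close> with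
  \<open>u = u\<^sub>1 \<dots> u\<^sub>k\<close> and \<open>v = v\<^sub>1 \<dots> v\<^sub>k\<close>.\<close>

lemma shuffles_eq_factorizations:
  "shuffles u v =
     {concat (map2 (@) us vs) | us vs. length us = length vs \<and> concat us = u \<and> concat vs = v}"
  (is "_ = ?R u v")
proof (intro equalityI subsetI)
  fix w assume "w \<in> shuffles u v"
  then show "w \<in> ?R u v"
  proof (induction u v arbitrary: w rule: shuffles.induct)
    case (1 ys)
    then have "w = concat (map2 (@) [[]] [ys])" by simp
    then show ?case by (intro CollectI exI[of _ "[[]]"] exI[of _ "[ys]"]) auto
  next
    case (2 xs)
    then have "w = concat (map2 (@) [xs] [[]])" by simp
    then show ?case by (intro CollectI exI[of _ "[xs]"] exI[of _ "[[]]"]) auto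
  next
    case (3 x xs y ys)
    from "3.prems" consider
      w' where "w = x # w'" "w' \<in> shuffles xs (y # ys)"
      | w' where "w = y # w'" "w' \<in> shuffles (x # xs) ys" by auto
    then show ?case
    proof cases
      case 1
      then obtain us vs where "w' = concat (map2 (@) us vs)" "length us = length vs"
        "concat us = xs" "concat vs = y # ys" using "3.IH"(1) by blast
      with 1 show ?thesis
        by (intro CollectI exI[of _ "[x] # us"] exI[of _ "[] # vs"]) auto
    next
      case 2
      then obtain us vs where "w' = concat (map2 (@) us vs)" "length us = length vs"
        "concat us = x # xs" "concat vs = ys" using "3.IH"(2) by blast
      with 2 show ?thesis
        by (intro CollectI exI[of _ "[] # us"] exI[of _ "[y] # vs"]) auto
    qed
  qed
next
  fix w assume "w \<in> ?R u v"
  then obtain us vs where *: "w = concat (map2 (@) us vs)" "length us = length vs"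
    "concat us = u" "concat vs = v" by blast
  have "concat (map2 (@) us vs) \<in> shuffles (concat us) (concat vs)"
    using *(2) by (induction us vs rule: list_induct2) (auto intro: shuffles_append)
  with * show "w \<in> shuffles u v" by simp
qed

end

(* Run both automata on all ways of splitting the input; the resulting subset automaton has subsets
   of A \<times> B as states. A set arising this way meets the row of the initial state of A and the
   column of the initial state of B, since the whole input may be given to one of the automata.
   The subsets with this property are closed under transitions, and their number is the bound:
   2^(mn-1) of them contain the pair of initial states, the other summand counts the rest. *)
theory Submission
  imports Defs
begin

text \<open>A set collects the pairs of states reached over all splittings of the input, and
  \<open>step\<close> gives the next letter to either automaton. The row and column conditions are
  built into \<open>states\<close> because \<open>card (states M)\<close> counts every listed state,
  reachable or not. \<open>final\<close> repeats them so that it is contained in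
  \<open>states\<close>.\<close>

definition shuffle_dfa :: "('s, 'a) dfa \<Rightarrow> ('t, 'a) dfa \<Rightarrow> (('s \<times> 't) set, 'a) dfa" where
  "shuffle_dfa M N =
     \<lparr>states = {S. S \<subseteq> states M \<times> states N \<and>
                   (\<exists>p. (p, initial N) \<in> S) \<and> (\<exists>q. (initial M, q) \<in> S)},
      initial = {(initial M, initial N)},
      final = {S. S \<subseteq> states M \<times> states N \<and>
                  (\<exists>p. (p, initial N) \<in> S) \<and> (\<exists>q. (initial M, q) \<in> S) \<and>
                  S \<inter> final M \<times> final N \<noteq> {}},
      step = (\<lambda>S a. (\<lambda>(p, q). (step M p a, q)) ` S \<union> (\<lambda>(p, q). (p, step N q a)) ` S)\<rparr>"

lemma mem_states_shuffle_dfa: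
  "S \<in> states (shuffle_dfa M N) \<longleftrightarrow> S \<subseteq> states M \<times> states N \<and>
     (\<exists>p. (p, initial N) \<in> S) \<and> (\<exists>q. (initial M, q) \<in> S)"
  by (simp add: shuffle_dfa_def)

text \<open>Closure under \<open>step\<close> rests on both ways of giving away a letter: if
  \<open>M\<close> reads it, a pair in the column of \<open>initial N\<close> stays in that column;
  if \<open>N\<close> reads it, a pair in the row of \<open>initial M\<close> stays in that
  row.\<close>

lemma complete_shuffle_dfa:
  assumes "complete_dfa \<Sigma> M" "complete_dfa \<Sigma> N"
  shows "complete_dfa \<Sigma> (shuffle_dfa M N)"
proof -
  have "finite (states (shuffle_dfa M N))"
    by (rule finite_subset[of _ "Pow (states M \<times> states N)"])
       (use assms in \<open>auto simp: shuffle_dfa_def complete_dfa_def\<close>)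
  moreover have "initial (shuffle_dfa M N) \<in> states (shuffle_dfa M N)"
    using assms by (auto simp: shuffle_dfa_def complete_dfa_def)
  moreover have "final (shuffle_dfa M N) \<subseteq> states (shuffle_dfa M N)"
    by (auto simp: shuffle_dfa_def)
  moreover have "step (shuffle_dfa M N) S a \<in> states (shuffle_dfa M N)"
    if S: "S \<in> states (shuffle_dfa M N)" and a: "a \<in> \<Sigma>" for S a
  proof -
    from S obtain p q where "(p, initial N) \<in> S" "(initial M, q) \<in> S"
      by (auto simp: shuffle_dfa_def)
    then have "(step M p a, initial N) \<in> step (shuffle_dfa M N) S a"
      "(initial M, step N q a) \<in> step (shuffle_dfa M N) S a"
      by (force simp: shuffle_dfa_def)+
    moreover have "step (shuffle_dfa M N) S a \<subseteq> states M \<times> states N"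
      using S a assms by (auto simp: shuffle_dfa_def complete_dfa_def)
    ultimately show ?thesis unfolding mem_states_shuffle_dfa by blast
  qed
  ultimately show ?thesis by (auto simp: complete_dfa_def)
qed

lemma foldl_step_in_states:
  assumes "complete_dfa \<Sigma> M" "q \<in> states M" "w \<in> lists \<Sigma>"
  shows "foldl (step M) q w \<in> states M"
  using assms(3,2) by (induction w arbitrary: q) (use assms(1) in \<open>auto simp: complete_dfa_def\<close>)

text \<open>The start set is arbitrary because the induction removes the first letter and continues
  from the successor set, which is no longer a singleton in general.\<close>

lemma foldl_step_shuffle_dfa:
  "foldl (step (shuffle_dfa M N)) S w =
     {(foldl (step M) p u, foldl (step N) q v) | p q u v. (p, q) \<in> S \<and> w \<in> shuffles u v}"
proof (induction w arbitrary: S)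
  case Nil
  then show ?case by simp
next
  case (Cons a w)
  \<comment> \<open>The two sets separate the runs by which automaton reads the first letter
    \<open>a\<close>.\<close>
  have "foldl (step (shuffle_dfa M N)) S (a # w) =
      {(foldl (step M) (step M p a) u, foldl (step N) q v) | p q u v. (p, q) \<in> S \<and> w \<in> shuffles u v}
    \<union> {(foldl (step M) p u, foldl (step N) (step N q a) v) | p q u v. (p, q) \<in> S \<and> w \<in> shuffles u v}"
    unfolding foldl_Cons Cons.IH by (fastforce simp: shuffle_dfa_def)
  also have "\<dots> = {(foldl (step M) p u, foldl (step N) q v) | p q u v.
                       (p, q) \<in> S \<and> a # w \<in> shuffles u v}"
    (is "?A \<union> ?B = ?C")
  proof (intro equalityI subsetI)
    fix x assume "x \<in> ?A \<union> ?B"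
    then show "x \<in> ?C"
    proof
      assume "x \<in> ?A"
      then obtain p q u v where
        x: "x = (foldl (step M) (step M p a) u, foldl (step N) q v)" "(p, q) \<in> S" "w \<in> shuffles u v"
        by blast
      then have "x = (foldl (step M) p (a # u), foldl (step N) q v)" by simp
      then show ?thesis using x(2) Cons_in_shuffles_leftI[OF x(3)] by blast
    next
      assume "x \<in> ?B"
      then obtain p q u v where
        x: "x = (foldl (step M) p u, foldl (step N) (step N q a) v)" "(p, q) \<in> S" "w \<in> shuffles u v"
        by blast
      then have "x = (foldl (step M) p u, foldl (step N) q (a # v))" by simp
      then show ?thesis using x(2) Cons_in_shuffles_rightI[OF x(3)] by blast
    qed
  next
    fix x assume "x \<in> ?C"
    then obtain p q u v where x: "x = (foldl (step M) p u, foldl (step N) q v)" "(p, q) \<in> S"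
      and "a # w \<in> shuffles u v" by blast
    \<comment> \<open>The first letter of a shuffle is the first letter of one of the two
      words.\<close>
    then consider u' where "u = a # u'" "w \<in> shuffles u' v"
      | v' where "v = a # v'" "w \<in> shuffles u v'"
      by (cases u; cases v) auto
    then show "x \<in> ?A \<union> ?B" using x by cases auto
  qed
  finally show ?case .
qed

text \<open>Started at the singleton of initial states, the run on \<open>w\<close> reaches an
  accepting pair exactly if \<open>w\<close> is a shuffle of a word accepted by \<open>M\<close> and
  a word accepted by \<open>N\<close>.\<close>

lemma dfa_lang_shuffle_dfa:
  assumes "complete_dfa \<Sigma> M" "complete_dfa \<Sigma> N"
  shows "dfa_lang \<Sigma> (shuffle_dfa M N) = shuffle_lang (dfa_lang \<Sigma> M) (dfa_lang \<Sigma> N)"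
    (is "?D = ?R")
proof -
  \<comment> \<open>A shuffle has exactly the letters of its two words; this matches the restriction
    to \<open>lists \<Sigma>\<close> on both sides.\<close>
  have letters: "w \<in> lists \<Sigma> \<longleftrightarrow> u \<in> lists \<Sigma> \<and> v \<in> lists \<Sigma>" if "w \<in> shuffles u v" for w u v
    using set_shuffles[OF that] by auto
  have accept: "S \<in> final (shuffle_dfa M N) \<longleftrightarrow> S \<inter> final M \<times> final N \<noteq> {}"
    if "S \<in> states (shuffle_dfa M N)" for S
    using that by (simp add: shuffle_dfa_def)
  have "initial (shuffle_dfa M N) \<in> states (shuffle_dfa M N)"
    using complete_shuffle_dfa[OF assms] by (simp add: complete_dfa_def)
  then have run: "foldl (step (shuffle_dfa M N)) (initial (shuffle_dfa M N)) w \<in> states (shuffle_dfa M N)"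
    if "w \<in> lists \<Sigma>" for w
    using foldl_step_in_states[OF complete_shuffle_dfa[OF assms]] that by blast
  have init: "initial (shuffle_dfa M N) = {(initial M, initial N)}"
    by (simp add: shuffle_dfa_def)
  have "w \<in> ?D \<longleftrightarrow> w \<in> ?R" for w
  proof (cases "w \<in> lists \<Sigma>")
    case True
    then have "w \<in> ?D \<longleftrightarrow>
        foldl (step (shuffle_dfa M N)) (initial (shuffle_dfa M N)) w \<inter> final M \<times> final N \<noteq> {}"
      by (simp add: dfa_lang_def accept[OF run])
    also have "\<dots> \<longleftrightarrow> (\<exists>u v. w \<in> shuffles u v \<and>
        foldl (step M) (initial M) u \<in> final M \<and> foldl (step N) (initial N) v \<in> final N)"
      unfolding init foldl_step_shuffle_dfa by blast
    also have "\<dots> \<longleftrightarrow> w \<in> ?R"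
      using letters True unfolding shuffle_lang_def dfa_lang_def by blast
    finally show ?thesis .
  next
    case False
    then show ?thesis
      using letters unfolding shuffle_lang_def dfa_lang_def by blast
  qed
  then show ?thesis by blast
qed

text \<open>Sets containing \<open>(a, b)\<close> are free elsewhere, which gives the first summand.
  Any other set is fixed by its part off the row and column, a nonempty part of the column without
  \<open>a\<close>, and a nonempty part of the row without \<open>b\<close>. As
  \<open>a \<in> A\<close> and \<open>b \<in> B\<close>, no subtraction of 1 is truncated.\<close>

lemma card_subsets_meeting_row_and_column:
  assumes A: "finite A" "a \<in> A" and B: "finite B" "b \<in> B"
  shows "card {S. S \<subseteq> A \<times> B \<and> (\<exists>p. (p, b) \<in> S) \<and> (\<exists>q. (a, q) \<in> S)}
    \<le> 2 ^ (card A * card B - 1) +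
       2 ^ ((card A - 1) * (card B - 1)) * (2 ^ (card A - 1) - 1) * (2 ^ (card B - 1) - 1)"
proof -
  let ?with = "insert (a, b) ` Pow (A \<times> B - {(a, b)})"
  let ?params = "Pow ((A - {a}) \<times> (B - {b})) \<times> (Pow (A - {a}) - {{}}) \<times> (Pow (B - {b}) - {{}})"
  let ?glue = "\<lambda>(R, P, Q). R \<union> P \<times> {b} \<union> {a} \<times> Q"
  have "{S. S \<subseteq> A \<times> B \<and> (\<exists>p. (p, b) \<in> S) \<and> (\<exists>q. (a, q) \<in> S)} \<subseteq> ?with \<union> ?glue ` ?params"
  proof
    fix S assume "S \<in> {S. S \<subseteq> A \<times> B \<and> (\<exists>p. (p, b) \<in> S) \<and> (\<exists>q. (a, q) \<in> S)}"
    then have S: "S \<subseteq> A \<times> B" "\<exists>p. (p, b) \<in> S" "\<exists>q. (a, q) \<in> S" by auto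
    show "S \<in> ?with \<union> ?glue ` ?params"
    proof (cases "(a, b) \<in> S")
      case True
      then have "S = insert (a, b) (S - {(a, b)})" by auto
      then show ?thesis using S(1) by blast
    next
      case False
      define R where "R = S \<inter> (A - {a}) \<times> (B - {b})"
      \<comment> \<open>\<open>P\<close> and \<open>Q\<close> omit \<open>a\<close> and
        \<open>b\<close> because \<open>(a, b)\<close> is not in \<open>S\<close>, and they are
        nonempty because \<open>S\<close> meets the column and the row.\<close>
      define P where "P = {p. (p, b) \<in> S}"
      define Q where "Q = {q. (a, q) \<in> S}"
      have "S = ?glue (R, P, Q)"
        using S(1) by (auto simp: R_def P_def Q_def)
      moreover have "(R, P, Q) \<in> ?params"
        using S False by (auto simp: R_def P_def Q_def)
      ultimately show ?thesis by blast
    qed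
  qed
  then have "card {S. S \<subseteq> A \<times> B \<and> (\<exists>p. (p, b) \<in> S) \<and> (\<exists>q. (a, q) \<in> S)}
      \<le> card (?with \<union> ?glue ` ?params)"
    using A B by (intro card_mono) auto
  also have "\<dots> \<le> card ?with + card (?glue ` ?params)" by (rule card_Un_le)
  \<comment> \<open>An image has at most as many elements as its parameter set, and an upper bound
    is all that is claimed.\<close>
  also have "\<dots> \<le> card (Pow (A \<times> B - {(a, b)})) + card ?params"
    using A B by (intro add_mono card_image_le) auto
  also have "card (Pow (A \<times> B - {(a, b)})) = 2 ^ (card A * card B - 1)"
    using A B by (simp add: card_Pow card_cartesian_product)
  also have "card ?params =
      2 ^ ((card A - 1) * (card B - 1)) * (2 ^ (card A - 1) - 1) * (2 ^ (card B - 1) - 1)"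
    using A B by (simp add: card_Pow card_cartesian_product card_Diff_singleton)
  finally show ?thesis .
qed

text \<open>Regularity makes the set of possible sizes nonempty, so its least element is attained.
  This supplies automata with exactly \<open>m\<close> and \<open>n\<close> states.\<close>

lemma state_complexity_witness:
  assumes "regular_lang \<Sigma> L"
  obtains M :: "(nat, 'a) dfa" where
    "complete_dfa \<Sigma> M" "dfa_lang \<Sigma> M = L" "card (states M) = state_complexity \<Sigma> L"
proof -
  have "\<exists>k. \<exists>M :: (nat, 'a) dfa. complete_dfa \<Sigma> M \<and> dfa_lang \<Sigma> M = L \<and> card (states M) = k"
    using assms by (auto simp: regular_lang_def)
  from LeastI_ex[OF this] show ?thesis
    using that unfolding state_complexity_def by blast
qed

lemma regular_lang_dfa_lang:
  fixes M :: "('s, 'a) dfa"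
  assumes "complete_dfa \<Sigma> M"
  shows "regular_lang \<Sigma> (dfa_lang \<Sigma> M)"
  using complete_dfa_nat_states[OF assms] by (auto simp: regular_lang_def)

text \<open>The states of \<open>shuffle_dfa\<close> are sets of pairs, while
  \<open>state_complexity\<close> ranges over automata on \<open>nat\<close>; renaming the states
  bridges the two types.\<close>

lemma state_complexity_dfa_lang_le:
  fixes M :: "('s, 'a) dfa"
  assumes "complete_dfa \<Sigma> M"
  shows "state_complexity \<Sigma> (dfa_lang \<Sigma> M) \<le> card (states M)"
  unfolding state_complexity_def by (rule Least_le) (rule complete_dfa_nat_states[OF assms])

theorem theorem3:
  fixes \<Sigma> :: "'a set" and K L :: "'a list set" and m n :: nat
  assumes "finite \<Sigma>" and "\<Sigma> \<noteq> {}"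
    and "regular_lang \<Sigma> K" and "regular_lang \<Sigma> L"
    and "state_complexity \<Sigma> K = m" and "state_complexity \<Sigma> L = n"
  shows "regular_lang \<Sigma> (shuffle_lang K L) \<and>
    state_complexity \<Sigma> (shuffle_lang K L)
      \<le> 2 ^ (m * n - 1) + 2 ^ ((m - 1) * (n - 1)) * (2 ^ (m - 1) - 1) * (2 ^ (n - 1) - 1)"
proof -
  obtain M :: "(nat, 'a) dfa" where M: "complete_dfa \<Sigma> M" "dfa_lang \<Sigma> M = K" "card (states M) = m"
    using state_complexity_witness assms(3,5) by metis
  obtain N :: "(nat, 'a) dfa" where N: "complete_dfa \<Sigma> N" "dfa_lang \<Sigma> N = L" "card (states N) = n"
    using state_complexity_witness assms(4,6) by metis
  let ?D = "shuffle_dfa M N"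
  have D: "complete_dfa \<Sigma> ?D" "dfa_lang \<Sigma> ?D = shuffle_lang K L"
    using complete_shuffle_dfa[OF M(1) N(1)] dfa_lang_shuffle_dfa[OF M(1) N(1)] M(2) N(2) by simp_all
  have "finite (states M)" "initial M \<in> states M" "finite (states N)" "initial N \<in> states N"
    using M(1) N(1) by (auto simp: complete_dfa_def)
  from card_subsets_meeting_row_and_column[OF this] have
    "card (states ?D)
      \<le> 2 ^ (m * n - 1) + 2 ^ ((m - 1) * (n - 1)) * (2 ^ (m - 1) - 1) * (2 ^ (n - 1) - 1)"
    by (simp add: shuffle_dfa_def M(3) N(3))
  then show ?thesis
    using regular_lang_dfa_lang[OF D(1)] state_complexity_dfa_lang_le[OF D(1)] D(2) by simp
qed

end
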